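(* Let $p$ be prime and $k,n\in\mathbb{N}$. Then $$\operatorname{rank}_{\mathbb{Z}/p\mathbb{Z}}(\mathcal{A}^*_{p^k,n})\leq 2n\binom{\lfloor p^k/2\rfloor+(n-1)(p-1)+n}{n}.$$
   Context: Let $R=\mathbb{Z}/p^k\mathbb{Z}$. For $x,y\in R^n$, $\langle x,y\rangle=\sum_i x_iy_i\in R$. Let $\mathbb{S}^{n-1}(R)$ be the set of vectors in $R^n$ having at least one coordinate invertible in $R$, and $\mathbb{P}R^{n-1}=\mathbb{S}^{n-1}(R)/R^\times$ (nondegenerate directions; $b\sim\lambda b$ for $\lambda\in R^\times$). For $a\in R^n$ and $b\in\mathbb{P}R^{n-1}$, $H_b(a)=\{x\in R^n:\langle x-a,b\rangle=0\text{ in }R\}$. The matrix $\mathcal{A}^*_{p^k,n}$ has rows indexed by $(a,b)\in R^n\times\mathbb{P}R^{n-1}$, columns indexed by $x\in R^n$, and entry $1$ if $x\in H_b(a)$, $0$ otherwise; rank is over $\mathbb{Z}/p\mathbb{Z}$. *)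

theory Defs
  imports
    "HOL-Number_Theory.Residues"
    "Jordan_Normal_Form.Missing_VectorSpace"
begin

text \<open>
  The ring of integers modulo \<open>m\<close>. For \<open>m > 1\<close> this is \<^const>\<open>residue_ring\<close>; the
  unit element is reduced modulo \<open>m\<close> so that \<open>m = 1\<close> yields the zero ring, whose only
  element is invertible.
\<close>

definition Zmod :: "nat \<Rightarrow> int ring"
  where "Zmod m = (residue_ring (int m))\<lparr>one := 1 mod int m\<rparr>"

lemma Zmod_eq_residue_ring: "m > 1 \<Longrightarrow> Zmod m = residue_ring (int m)"
  by (simp add: Zmod_def residue_ring_def)

lemma cring_Zmod:
  assumes "m > 0"
  shows "cring (Zmod m)"
proof (cases "m = 1")
  case True
  have Z: "Zmod m = \<lparr>carrier = {0}, monoid.mult = \<lambda>x y. 0, one = 0, zero = 0, add = \<lambda>x y. 0\<rparr>"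
    using True by (simp add: Zmod_def residue_ring_def)
  have "abelian_group (Zmod m)"
    by (rule abelian_groupI) (simp_all add: Z)
  moreover have "comm_monoid (Zmod m)"
    by (rule comm_monoidI) (simp_all add: Z)
  ultimately show ?thesis
    by (rule cringI) (simp add: Z)
next
  case False
  with assms have m: "m > 1" by simp
  then have "residues (int m)"
    by (simp add: residues_def)
  from residues.cring[OF this] m show ?thesis
    by (simp add: Zmod_eq_residue_ring)
qed

context
  fixes R :: "('a, 'b) ring_scheme" (structure) and n :: nat
begin

definition vecs :: "(nat \<Rightarrow> 'a) set"
  where "vecs = {..<n} \<rightarrow>\<^sub>E carrier R"

definition vec_inner :: "(nat \<Rightarrow> 'a) \<Rightarrow> (nat \<Rightarrow> 'a) \<Rightarrow> 'a"
  where "vec_inner x y = (\<Oplus>i\<in>{..<n}. x i \<otimes> y i)"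

definition vec_minus :: "(nat \<Rightarrow> 'a) \<Rightarrow> (nat \<Rightarrow> 'a) \<Rightarrow> nat \<Rightarrow> 'a"
  where "vec_minus x y = (\<lambda>i\<in>{..<n}. x i \<ominus> y i)"

definition vec_scale :: "'a \<Rightarrow> (nat \<Rightarrow> 'a) \<Rightarrow> nat \<Rightarrow> 'a"
  where "vec_scale c x = (\<lambda>i\<in>{..<n}. c \<otimes> x i)"

definition unit_sphere :: "(nat \<Rightarrow> 'a) set"
  where "unit_sphere = {b \<in> vecs. \<exists>i<n. b i \<in> Units R}"

definition proj_rel :: "((nat \<Rightarrow> 'a) \<times> (nat \<Rightarrow> 'a)) set"
  where "proj_rel = {(b, c). b \<in> unit_sphere \<and> c \<in> unit_sphere \<and> (\<exists>u\<in>Units R. c = vec_scale u b)}"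

definition proj_space :: "(nat \<Rightarrow> 'a) set set"
  where "proj_space = unit_sphere // proj_rel"

definition vec_hyperplane :: "(nat \<Rightarrow> 'a) \<Rightarrow> (nat \<Rightarrow> 'a) \<Rightarrow> (nat \<Rightarrow> 'a) set"
  where "vec_hyperplane a b = {x \<in> vecs. vec_inner (vec_minus x a) b = \<zero>}"

text \<open>
  The hyperplane with direction in projective space: the union is over representatives
  that all define the same set, see \<open>proj_hyperplane_class\<close> below.
\<close>

definition proj_hyperplane :: "(nat \<Rightarrow> 'a) \<Rightarrow> (nat \<Rightarrow> 'a) set \<Rightarrow> (nat \<Rightarrow> 'a) set"
  where "proj_hyperplane a B = (\<Union>b\<in>B. vec_hyperplane a b)"

end

context cring
begin

lemma vec_scale_in_vecs: "u \<in> carrier R \<Longrightarrow> b \<in> vecs R n \<Longrightarrow> vec_scale R n u b \<in> vecs R n"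
  by (auto simp: vecs_def vec_scale_def PiE_def Pi_def)

lemma vec_scale_one: "b \<in> vecs R n \<Longrightarrow> vec_scale R n \<one> b = b"
  by (auto simp: vecs_def vec_scale_def PiE_def Pi_def extensional_def fun_eq_iff)

lemma vec_scale_scale:
  "u \<in> carrier R \<Longrightarrow> v \<in> carrier R \<Longrightarrow> b \<in> vecs R n \<Longrightarrow>
    vec_scale R n u (vec_scale R n v b) = vec_scale R n (u \<otimes> v) b"
  by (auto simp: vecs_def vec_scale_def PiE_def Pi_def fun_eq_iff m_assoc)

lemma equiv_proj_rel: "equiv (unit_sphere R n) (proj_rel R n)"
proof (rule equivI)
  show "proj_rel R n \<subseteq> unit_sphere R n \<times> unit_sphere R n"
    by (auto simp: proj_rel_def)
  show "refl_on (unit_sphere R n) (proj_rel R n)"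
  proof (rule refl_onI)
    fix b assume b: "b \<in> unit_sphere R n"
    then have "vec_scale R n \<one> b = b"
      by (simp add: unit_sphere_def vec_scale_one)
    with b show "(b, b) \<in> proj_rel R n"
      unfolding proj_rel_def using Units_one_closed by force
  qed
  show "sym (proj_rel R n)"
  proof (rule symI)
    fix b c assume bc: "(b, c) \<in> proj_rel R n"
    then obtain u where u: "u \<in> Units R" "c = vec_scale R n u b"
      by (auto simp: proj_rel_def)
    with bc have "b = vec_scale R n (inv u) c"
      by (simp add: vec_scale_scale proj_rel_def unit_sphere_def Units_closed vec_scale_one)
    moreover have "inv u \<in> Units R" "b \<in> unit_sphere R n" "c \<in> unit_sphere R n"
      using bc u(1) by (simp_all add: proj_rel_def)
    ultimately show "(c, b) \<in> proj_rel R n"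
      unfolding proj_rel_def by blast
  qed
  show "trans (proj_rel R n)"
  proof (rule transI)
    fix b c d assume bc: "(b, c) \<in> proj_rel R n" and cd: "(c, d) \<in> proj_rel R n"
    then obtain u v where uv: "u \<in> Units R" "c = vec_scale R n u b" "v \<in> Units R" "d = vec_scale R n v c"
      by (auto simp: proj_rel_def)
    with bc have "d = vec_scale R n (v \<otimes> u) b"
      by (simp add: vec_scale_scale proj_rel_def unit_sphere_def Units_closed)
    with bc cd uv show "(b, d) \<in> proj_rel R n"
      unfolding proj_rel_def using Units_m_closed by blast
  qed
qed

lemma vec_inner_scale:
  assumes "u \<in> carrier R" "x \<in> vecs R n" "b \<in> vecs R n"
  shows "vec_inner R n x (vec_scale R n u b) = u \<otimes> vec_inner R n x b"
proof -
  have "vec_inner R n x (vec_scale R n u b) = (\<Oplus>i\<in>{..<n}. u \<otimes> (x i \<otimes> b i))"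
    unfolding vec_inner_def using assms
    by (intro finsum_cong') (auto simp: vec_scale_def vecs_def PiE_def Pi_def m_lcomm)
  also have "\<dots> = u \<otimes> vec_inner R n x b"
    unfolding vec_inner_def using assms
    by (intro finsum_rdistr[symmetric]) (auto simp: vecs_def PiE_def Pi_def)
  finally show ?thesis .
qed

lemma vec_inner_closed:
  "x \<in> vecs R n \<Longrightarrow> b \<in> vecs R n \<Longrightarrow> vec_inner R n x b \<in> carrier R"
  unfolding vec_inner_def by (intro finsum_closed) (auto simp: vecs_def PiE_def Pi_def)

lemma vec_hyperplane_scale:
  assumes "u \<in> Units R" "a \<in> vecs R n" "b \<in> vecs R n"
  shows "vec_hyperplane R n a (vec_scale R n u b) = vec_hyperplane R n a b"
proof -
  have "vec_inner R n (vec_minus R n x a) (vec_scale R n u b) = \<zero> \<longleftrightarrow>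
        vec_inner R n (vec_minus R n x a) b = \<zero>" if x: "x \<in> vecs R n" for x
  proof -
    have d: "vec_minus R n x a \<in> vecs R n"
      using x assms(2) by (auto simp: vecs_def vec_minus_def PiE_def Pi_def)
    let ?t = "vec_inner R n (vec_minus R n x a) b"
    have t: "?t \<in> carrier R" using d assms(3) by (rule vec_inner_closed)
    have "u \<otimes> ?t = \<zero> \<longleftrightarrow> ?t = \<zero>"
      using Units_l_cancel[OF assms(1) t zero_closed] assms(1) by (simp add: Units_closed)
    with d assms show ?thesis by (simp add: vec_inner_scale Units_closed)
  qed
  then show ?thesis by (auto simp: vec_hyperplane_def)
qed

lemma proj_hyperplane_class:
  assumes "a \<in> vecs R n" "B \<in> proj_space R n" "b \<in> B"
  shows "proj_hyperplane R n a B = vec_hyperplane R n a b"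
proof -
  have "vec_hyperplane R n a c = vec_hyperplane R n a b" if "c \<in> B" for c
  proof -
    have "(b, c) \<in> proj_rel R n"
      using assms(2,3) that unfolding proj_space_def
      by (intro in_quotient_imp_in_rel[OF equiv_proj_rel]) auto
    then show ?thesis
      using assms(1) by (auto simp: proj_rel_def unit_sphere_def vec_hyperplane_scale)
  qed
  moreover have "B \<noteq> {}" using assms(3) by auto
  ultimately show ?thesis unfolding proj_hyperplane_def by (intro SUP_eq_const)
qed

end

text \<open>
  Rank over a field \<open>K\<close> of a matrix with rows indexed by \<open>I\<close> and columns indexed by \<open>J\<close>:
  the dimension of the span of its rows in the space of functions from \<open>J\<close> to \<open>K\<close>.
\<close>

definition matrix_rank :: "('a, 'b) ring_scheme \<Rightarrow> 'i set \<Rightarrow> 'j set \<Rightarrow> ('i \<Rightarrow> 'j \<Rightarrow> 'a) \<Rightarrow> nat"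
  where "matrix_rank K I J M =
    (let V = ring.func_space K J
     in vectorspace.dim K (V\<lparr>carrier := module.span K V ((\<lambda>i. restrict (M i) J) ` I)\<rparr>))"

definition Astar :: "nat \<Rightarrow> nat \<Rightarrow> nat \<Rightarrow> (nat \<Rightarrow> int) \<times> (nat \<Rightarrow> int) set \<Rightarrow> (nat \<Rightarrow> int) \<Rightarrow> int"
  where "Astar p k n = (\<lambda>(a, B) x. if x \<in> proj_hyperplane (Zmod (p ^ k)) n a B
      then \<one>\<^bsub>residue_ring (int p)\<^esub> else \<zero>\<^bsub>residue_ring (int p)\<^esub>)"

definition rank_Astar :: "nat \<Rightarrow> nat \<Rightarrow> nat \<Rightarrow> nat"
  where "rank_Astar p k n =
    matrix_rank (residue_ring (int p))
      (vecs (Zmod (p ^ k)) n \<times> proj_space (Zmod (p ^ k)) n) (vecs (Zmod (p ^ k)) n) (Astar p k n)"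

end

(*
  Put q = p^k and let i0 be a unit coordinate of the direction, scaled to 1. The hyperplane is then
  the set of x for which t + 1 = 0 in Z/q, where t = c + x_i0 + sum_(i /= i0) b_i x_i, and modulo p
  its indicator is binomial(t, q - 1), the coefficient of z^(q - 1) in (1 + z)^t.

  Expand (1 + z)^(b x) = sum_(s,u) N(s,u) binomial(b, s) binomial(x, u). The coefficient of z^m in
  N(s,u) counts the m-element subsets of an s x u grid that meet every row and every column, and
  modulo p it vanishes unless m >= s + u - 2 (p - 1). So every monomial
  prod binomial(x_i, sigma_i) prod binomial(b_i, tau_i) that survives modulo p in the expansion of
  the indicator has |sigma| + |tau| <= q - 1 + 2 (n - 1) (p - 1), whence |sigma| or |tau| is at most
  d = floor(q/2) + (n - 1) (p - 1). Collecting the terms by sigma in the first case and by tau in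
  the second, the rows with a given i0 lie in the span of 2 binomial(d + n, n) functions of x.
*)

theory Submission
  imports Defs "HOL-Computational_Algebra.Polynomial"
begin

section \<open>The filtration by the ideals (p, z^e)\<close>

text \<open>The ideal \<open>(p, z ^ e)\<close> of an arbitrary commutative ring. It is applied to
  \<open>int poly\<close> with \<open>z\<close> the variable, where membership makes the
  coefficients below \<open>z ^ e\<close> divisible by \<open>p\<close>.\<close>

definition filt :: "nat \<Rightarrow> 'a::comm_ring_1 \<Rightarrow> nat \<Rightarrow> 'a set"
  where "filt p z e = {of_nat p * u + z ^ e * v | u v. True}"

lemma filtI: "x = of_nat p * u + z ^ e * v \<Longrightarrow> x \<in> filt p z e"
  by (auto simp: filt_def)

lemma filt_add: "x \<in> filt p z e \<Longrightarrow> y \<in> filt p z e \<Longrightarrow> x + y \<in> filt p z e"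
proof -
  assume "x \<in> filt p z e" "y \<in> filt p z e"
  then obtain a b a' b' where "x = of_nat p * a + z ^ e * b" "y = of_nat p * a' + z ^ e * b'"
    by (auto simp: filt_def)
  then show ?thesis by (intro filtI[of _ _ "a + a'" _ _ "b + b'"]) (simp add: algebra_simps)
qed

lemma filt_mult_right: "x \<in> filt p z e \<Longrightarrow> x * y \<in> filt p z e"
proof -
  assume "x \<in> filt p z e"
  then obtain a b where "x = of_nat p * a + z ^ e * b" by (auto simp: filt_def)
  then show ?thesis by (intro filtI[of _ _ "a * y" _ _ "b * y"]) (simp add: algebra_simps)
qed

lemma filt_mult_left: "x \<in> filt p z e \<Longrightarrow> y * x \<in> filt p z e"
  using filt_mult_right[of x p z e y] by (simp add: mult.commute)

lemma filt_diff: "x \<in> filt p z e \<Longrightarrow> y \<in> filt p z e \<Longrightarrow> x - y \<in> filt p z e"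
  using filt_add[of x p z e "- 1 * y"] filt_mult_left[of y p z e "- 1"] by simp

lemma filt_mono: "x \<in> filt p z e \<Longrightarrow> e' \<le> e \<Longrightarrow> x \<in> filt p z e'"
proof -
  assume "x \<in> filt p z e" and le: "e' \<le> e"
  then obtain a b where "x = of_nat p * a + z ^ e * b" by (auto simp: filt_def)
  then show ?thesis
    using le by (intro filtI[of _ _ a _ _ "z ^ (e - e') * b"]) (simp flip: power_add mult.assoc)
qed

lemma dvd_in_filt: "of_nat p dvd x \<Longrightarrow> x \<in> filt p z e"
  by (auto elim!: dvdE intro: filtI[of _ _ _ _ _ 0])

lemma in_filt_0 [simp]: "x \<in> filt p z 0"
  by (rule filtI[of _ _ 0 _ _ x]) simp

lemma power_in_filt [simp]: "z ^ e \<in> filt p z e"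
  by (rule filtI[of _ _ 0 _ _ 1]) simp

lemma filt_mult:
  assumes "x \<in> filt p z d" "y \<in> filt p z e"
  shows "x * y \<in> filt p z (d + e)"
proof -
  obtain a b where x: "x = of_nat p * a + z ^ d * b" using assms(1) by (auto simp: filt_def)
  obtain a' b' where y: "y = of_nat p * a' + z ^ e * b'" using assms(2) by (auto simp: filt_def)
  show ?thesis
    by (rule filtI[of _ _ "a * y + z ^ d * b * a'" _ _ "b * b'"])
      (simp add: x y power_add algebra_simps)
qed

lemma filt_power: "x \<in> filt p z e \<Longrightarrow> x ^ m \<in> filt p z (e * m)"
  by (induction m) (auto dest: filt_mult)

lemma filt_prod: "(\<And>i. i \<in> A \<Longrightarrow> f i \<in> filt p z (e i)) \<Longrightarrow> (\<Prod>i\<in>A. f i) \<in> filt p z (\<Sum>i\<in>A. e i)"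
  by (induction A rule: infinite_finite_induct) (auto intro: filt_mult)

lemma filt_cong: "of_nat p dvd x - y \<Longrightarrow> y \<in> filt p z e \<Longrightarrow> x \<in> filt p z e"
  using filt_add[OF dvd_in_filt[of p "x - y"]] by fastforce

text \<open>The inner coefficients \<open>p choose i\<close> are multiples of \<open>p\<close>. With
  \<open>f\<close> arbitrary this serves both the binomial theorem and Newton's formula for
  differences.\<close>

lemma prime_dvd_sum_binomial:
  fixes f :: "nat \<Rightarrow> 'a::comm_ring_1"
  assumes "prime p"
  shows "of_nat p dvd (\<Sum>i\<le>p. of_nat (p choose i) * f i) - f 0 - f p"
proof -
  have p: "p > 1" using assms by (rule prime_gt_1_nat)
  have "{..p} = insert 0 (insert p {0<..<p})" using p by auto
  then have "(\<Sum>i\<le>p. of_nat (p choose i) * f i) - f 0 - f p = (\<Sum>i\<in>{0<..<p}. of_nat (p choose i) * f i)"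
    using p by simp
  also have "of_nat p dvd \<dots>"
  proof (rule dvd_sum)
    fix i assume "i \<in> {0<..<p}"
    then have "p dvd p choose i"
      using assms by (intro dvd_choose_prime) auto
    then show "of_nat p dvd of_nat (p choose i) * f i"
      by (auto simp: dvd_def mult.assoc)
  qed
  finally show ?thesis .
qed

lemma prime_dvd_power_add:
  fixes x y :: "'a::comm_ring_1"
  assumes "prime p"
  shows "of_nat p dvd (x + y) ^ p - (x ^ p + y ^ p)"
proof -
  have "(x + y) ^ p - (x ^ p + y ^ p) =
      (\<Sum>i\<le>p. of_nat (p choose i) * (x ^ i * y ^ (p - i))) - x ^ 0 * y ^ (p - 0) - x ^ p * y ^ (p - p)"
    by (simp add: binomial_ring mult.assoc)
  then show ?thesis
    using prime_dvd_sum_binomial[OF assms, of "\<lambda>i. x ^ i * y ^ (p - i)"]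
    by (simp add: diff_diff_eq add.commute)
qed

text \<open>Splitting \<open>y\<close> as \<open>(y - 1) + 1\<close> avoids the sign
  \<open>(-1) ^ p\<close>, so \<open>p = 2\<close> is no exception.\<close>

lemma prime_dvd_power_minus_one:
  fixes y :: "'a::comm_ring_1"
  assumes "prime p"
  shows "of_nat p dvd (y ^ p - 1) - (y - 1) ^ p"
  using prime_dvd_power_add[OF assms, of "y - 1" 1] by (simp add: algebra_simps)

text \<open>Iterated Frobenius: each induction step takes a \<open>p\<close>-th power and so
  multiplies the exponent of \<open>z\<close> by \<open>p\<close>.\<close>

lemma one_plus_power_prime_power:
  assumes "prime p"
  shows "(1 + z) ^ (p ^ k) - 1 \<in> filt p z (p ^ k)"
proof (induction k)
  case 0
  show ?case using power_in_filt[of z 1 p] by simp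
next
  case (Suc k)
  have "((1 + z) ^ (p ^ k)) ^ p - 1 \<in> filt p z (p ^ k * p)"
    by (rule filt_cong[OF prime_dvd_power_minus_one[OF assms] filt_power[OF Suc]])
  then show ?case by (simp add: mult.commute flip: power_mult)
qed

section \<open>Finite differences\<close>

definition fdiff :: "nat \<Rightarrow> (nat \<Rightarrow> 'a::ab_group_add) \<Rightarrow> nat \<Rightarrow> 'a"
  where "fdiff c f = (\<lambda>j. f (j + c) - f j)"

text \<open>Newton's forward formula: the unit shift is \<open>1 + fdiff 1\<close>, and the
  induction is Pascal's rule, with \<open>j\<close> varying. The bound \<open>m\<close> makes the
  index range independent of \<open>x\<close>.\<close>

lemma newton_forward:
  fixes f :: "nat \<Rightarrow> 'a::comm_ring_1"
  assumes "x \<le> m"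
  shows "f (j + x) = (\<Sum>t\<le>m. of_nat (x choose t) * (fdiff 1 ^^ t) f j)"
  using assms
proof (induction x arbitrary: j)
  case 0
  have "(\<Sum>t\<le>m. of_nat (0 choose t) * (fdiff 1 ^^ t) f j) = (\<Sum>t\<in>{0}. of_nat (0 choose t) * (fdiff 1 ^^ t) f j)"
    by (intro sum.mono_neutral_right) (auto simp: binomial_eq_0)
  then show ?case by simp
next
  case (Suc x)
  let ?D = "\<lambda>t. (fdiff 1 ^^ t) f"
  obtain m' where m: "m = Suc m'" "x \<le> m'"
    using Suc.prems by (cases m) auto
  have "f (j + Suc x) = (\<Sum>t\<le>m. of_nat (x choose t) * ?D t (Suc j))"
    using Suc.IH[of "Suc j"] Suc.prems by simp
  also have "\<dots> = (\<Sum>t\<le>m. of_nat (x choose t) * ?D t j) + (\<Sum>t\<le>m. of_nat (x choose t) * ?D (Suc t) j)"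
    by (simp add: fdiff_def algebra_simps flip: sum.distrib)
  also have "(\<Sum>t\<le>m. of_nat (x choose t) * ?D (Suc t) j) = (\<Sum>t\<le>m'. of_nat (x choose t) * ?D (Suc t) j)"
    using m by (simp add: binomial_eq_0)
  also have "(\<Sum>t\<le>m. of_nat (x choose t) * ?D t j) = ?D 0 j + (\<Sum>t\<le>m'. of_nat (x choose Suc t) * ?D (Suc t) j)"
    unfolding m by (subst sum.atMost_Suc_shift) simp
  also have "?D 0 j + (\<Sum>t\<le>m'. of_nat (x choose Suc t) * ?D (Suc t) j)
      + (\<Sum>t\<le>m'. of_nat (x choose t) * ?D (Suc t) j) = (\<Sum>t\<le>m. of_nat (Suc x choose t) * ?D t j)"
    unfolding m sum.atMost_Suc_shift[of _ m'] by (simp add: ring_distribs sum.distrib)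
  finally show ?case .
qed

lemma fdiff_pow_sum:
  fixes f :: "'i \<Rightarrow> nat \<Rightarrow> 'a::comm_ring_1"
  shows "(fdiff c ^^ t) (\<lambda>j. \<Sum>i\<in>A. g i * f i j) = (\<lambda>j. \<Sum>i\<in>A. g i * (fdiff c ^^ t) (f i) j)"
  by (induction t) (auto simp: fdiff_def fun_eq_iff algebra_simps simp flip: sum_subtractf)

lemma fdiff_pow_cong_dvd:
  fixes f g :: "nat \<Rightarrow> 'a::comm_ring_1"
  assumes "\<And>j. a dvd f j - g j"
  shows "a dvd (fdiff c ^^ t) f j - (fdiff c ^^ t) g j"
proof (induction t arbitrary: j)
  case (Suc t)
  show ?case
    using dvd_diff[OF Suc[of "j + c"] Suc[of j]] by (simp add: fdiff_def algebra_simps)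
qed (simp add: assms)

text \<open>A shift by \<open>c\<close> multiplies \<open>y ^ j\<close> by \<open>y ^ c\<close>, so
  each difference contributes a factor \<open>y ^ c - 1\<close>. The constant \<open>1\<close> is
  killed by the first difference, hence \<open>t > 0\<close>.\<close>

lemma fdiff_pow_power_minus_one:
  fixes y :: "'a::comm_ring_1"
  assumes "t > 0"
  shows "(fdiff c ^^ t) (\<lambda>j. y ^ j - 1) = (\<lambda>j. (y ^ c - 1) ^ t * y ^ j)"
  using assms by (induction t rule: nat_induct_non_zero) (auto simp: fdiff_def fun_eq_iff power_add algebra_simps)

lemma fdiff_pow_filt:
  assumes "\<And>j. f j \<in> filt p z e"
  shows "(fdiff c ^^ t) f j \<in> filt p z e"
  by (induction t arbitrary: j) (auto simp: fdiff_def assms intro: filt_diff)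

text \<open>Frobenius for operators: with \<open>E\<close> the unit shift,
  \<open>(E - 1) ^ p\<close> is congruent to \<open>E ^ p - 1\<close>. Newton's formula for
  \<open>g (j + p)\<close> shows it, as all terms but the first and last are multiples of
  \<open>p\<close>.\<close>

lemma fdiff_prime_cong:
  fixes f :: "nat \<Rightarrow> 'a::comm_ring_1"
  assumes "prime p"
  shows "of_nat p dvd (fdiff 1 ^^ (p * t)) f j - (fdiff p ^^ t) f j"
proof (induction t arbitrary: j)
  case (Suc t)
  have one: "of_nat p dvd (fdiff 1 ^^ p) g j - fdiff p g j" for g :: "nat \<Rightarrow> 'a" and j
  proof -
    have "of_nat p dvd (\<Sum>i\<le>p. of_nat (p choose i) * (fdiff 1 ^^ i) g j) - g j - (fdiff 1 ^^ p) g j"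
      using prime_dvd_sum_binomial[OF assms, of "\<lambda>i. (fdiff 1 ^^ i) g j"] by simp
    then have "of_nat p dvd - (g (j + p) - g j - (fdiff 1 ^^ p) g j)"
      unfolding dvd_minus_iff by (subst newton_forward[of p p]) simp_all
    then show ?thesis by (simp add: fdiff_def algebra_simps)
  qed
  have "of_nat p dvd fdiff p ((fdiff 1 ^^ (p * t)) f) j - fdiff p ((fdiff p ^^ t) f) j"
    using fdiff_pow_cong_dvd[where t = 1 and c = p, OF Suc] by simp
  from dvd_add[OF one[of "(fdiff 1 ^^ (p * t)) f" j] this] show ?case
    by (simp add: funpow_add)
qed simp

text \<open>A smoothness class of order \<open>a\<close>: \<open>t = 0\<close> bounds the values,
  and each further difference must gain \<open>z ^ p\<close>. Requiring all \<open>t\<close> at once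
  makes orders add under products.\<close>

definition fdiff_filt :: "nat \<Rightarrow> 'a::comm_ring_1 \<Rightarrow> nat \<Rightarrow> (nat \<Rightarrow> 'a) set"
  where "fdiff_filt p z a = {f. \<forall>t j. (fdiff p ^^ t) f j \<in> filt p z (a + p * t)}"

lemma fdiff_filtD: "f \<in> fdiff_filt p z a \<Longrightarrow> (fdiff p ^^ t) f j \<in> filt p z (a + p * t)"
  by (simp add: fdiff_filt_def)

lemma fdiff_filt_fdiff: "f \<in> fdiff_filt p z a \<Longrightarrow> fdiff p f \<in> fdiff_filt p z (a + p)"
  unfolding fdiff_filt_def
proof clarsimp
  fix t j
  assume "\<forall>t j. (fdiff p ^^ t) f j \<in> filt p z (a + p * t)"
  then have "(fdiff p ^^ Suc t) f j \<in> filt p z (a + p * Suc t)" by blast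
  then show "(fdiff p ^^ t) (fdiff p f) j \<in> filt p z (a + p + p * t)"
    by (simp add: funpow_swap1 add.assoc)
qed

lemma fdiff_filt_shift:
  assumes "f \<in> fdiff_filt p z a"
  shows "(\<lambda>j. f (j + c)) \<in> fdiff_filt p z a"
proof -
  have "(fdiff p ^^ t) (\<lambda>j. f (j + c)) = (\<lambda>j. (fdiff p ^^ t) f (j + c))" for t
    by (induction t) (auto simp: fdiff_def fun_eq_iff add_ac)
  then show ?thesis using assms by (simp add: fdiff_filt_def)
qed

lemma fdiff_pow_add:
  fixes f :: "nat \<Rightarrow> 'a::comm_ring_1"
  shows "(fdiff c ^^ t) (\<lambda>j. f j + g j) = (\<lambda>j. (fdiff c ^^ t) f j + (fdiff c ^^ t) g j)"
  by (induction t) (auto simp: fdiff_def fun_eq_iff algebra_simps)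

text \<open>By the Leibniz rule one difference of \<open>f j * g j\<close> is a sum of two products,
  in each of which one factor has gained order \<open>p\<close>. The induction on \<open>t\<close>
  therefore generalises over both functions and both orders.\<close>

lemma fdiff_filt_mult:
  assumes "f \<in> fdiff_filt p z a" "g \<in> fdiff_filt p z b"
  shows "(\<lambda>j. f j * g j) \<in> fdiff_filt p z (a + b)"
proof -
  have "(fdiff p ^^ t) (\<lambda>j. f j * g j) j \<in> filt p z (a + b + p * t)" for t j
    using assms
  proof (induction t arbitrary: f g a b)
    case 0
    then show ?case
      using fdiff_filtD[of f p z a 0 j] fdiff_filtD[of g p z b 0 j] by (simp add: filt_mult)
  next
    case (Suc t)
    have leibniz: "fdiff p (\<lambda>j. f j * g j) = (\<lambda>j. fdiff p f j * g (j + p) + f j * fdiff p g j)"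
      by (auto simp: fdiff_def fun_eq_iff algebra_simps)
    have "(fdiff p ^^ Suc t) (\<lambda>j. f j * g j) j =
        (fdiff p ^^ t) (\<lambda>j. fdiff p f j * g (j + p)) j + (fdiff p ^^ t) (\<lambda>j. f j * fdiff p g j) j"
      unfolding funpow_Suc_right comp_apply leibniz fdiff_pow_add ..
    moreover have "(fdiff p ^^ t) (\<lambda>j. fdiff p f j * g (j + p)) j \<in> filt p z ((a + p) + b + p * t)"
      by (intro Suc.IH fdiff_filt_fdiff fdiff_filt_shift Suc.prems)
    moreover have "(fdiff p ^^ t) (\<lambda>j. f j * fdiff p g j) j \<in> filt p z (a + (b + p) + p * t)"
      by (intro Suc.IH fdiff_filt_fdiff Suc.prems)
    ultimately show ?case
      by (simp add: filt_add add_ac)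
  qed
  then show ?thesis by (simp add: fdiff_filt_def)
qed

lemma fdiff_filt_power: "f \<in> fdiff_filt p z a \<Longrightarrow> (\<lambda>j. f j ^ m) \<in> fdiff_filt p z (a * m)"
proof (induction m)
  case 0
  have "(fdiff p ^^ t) (\<lambda>j. 1) = (\<lambda>j. if t = 0 then 1 else (0::'a))" for t
    by (induction t) (auto simp: fdiff_def fun_eq_iff)
  then show ?case by (auto simp: fdiff_filt_def intro: dvd_in_filt)
next
  case (Suc m)
  then show ?case using fdiff_filt_mult[of f p z a "\<lambda>j. f j ^ m" "a * m"] by simp
qed

section \<open>Binomial expansion of a product\<close>

text \<open>The polynomial \<open>N(s,t)\<close> when \<open>z\<close> is a variable:
  \<open>((1 + z) ^ j - 1) ^ s\<close> enumerates the subsets of an \<open>s\<close> by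
  \<open>j\<close> grid that meet every row, and the \<open>t\<close>-th difference at 0 is
  inclusion-exclusion over the columns.\<close>

definition grid_coeff :: "'a::comm_ring_1 \<Rightarrow> nat \<Rightarrow> nat \<Rightarrow> 'a"
  where "grid_coeff z s t = (fdiff 1 ^^ t) (\<lambda>j. ((1 + z) ^ j - 1) ^ s) 0"

lemma power_eq_sum_choose:
  fixes y :: "'a::comm_ring_1"
  assumes "b \<le> m"
  shows "y ^ b = (\<Sum>s\<le>m. of_nat (b choose s) * (y - 1) ^ s)"
proof -
  have "y ^ b = ((y - 1) + 1) ^ b" by simp
  also have "\<dots> = (\<Sum>s\<le>b. of_nat (b choose s) * (y - 1) ^ s)"
    by (subst binomial_ring) simp
  also have "\<dots> = (\<Sum>s\<le>m. of_nat (b choose s) * (y - 1) ^ s)"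
    using assms by (intro sum.mono_neutral_left) (auto simp: binomial_eq_0)
  finally show ?thesis .
qed

text \<open>Read as \<open>((1 + z) ^ x) ^ b\<close>, the power is expanded by the binomial theorem
  in \<open>b\<close> and then by Newton's formula at 0 in \<open>x\<close>.\<close>

lemma one_plus_power_mult:
  fixes z :: "'a::comm_ring_1"
  assumes "b \<le> m" "x \<le> m"
  shows "(1 + z) ^ (b * x) =
    (\<Sum>s\<le>m. \<Sum>t\<le>m. of_nat (b choose s) * of_nat (x choose t) * grid_coeff z s t)"
proof -
  let ?h = "\<lambda>s j. ((1 + z) ^ j - 1) ^ s"
  have "(\<lambda>j. (1 + z) ^ (b * j)) = (\<lambda>j. \<Sum>s\<le>m. of_nat (b choose s) * ?h s j)"
    using power_eq_sum_choose[OF assms(1), of "(1 + z) ^ _"]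
    by (auto simp: fun_eq_iff mult.commute[of b] power_mult)
  then have "(fdiff 1 ^^ t) (\<lambda>j. (1 + z) ^ (b * j)) 0 = (\<Sum>s\<le>m. of_nat (b choose s) * grid_coeff z s t)" for t
    by (simp add: fdiff_pow_sum grid_coeff_def)
  then have "(1 + z) ^ (b * x) = (\<Sum>t\<le>m. \<Sum>s\<le>m. of_nat (b choose s) * of_nat (x choose t) * grid_coeff z s t)"
    using newton_forward[OF assms(2), of "\<lambda>j. (1 + z) ^ (b * j)" 0]
    by (simp add: sum_distrib_left algebra_simps)
  then show ?thesis by (subst sum.swap) simp
qed

text \<open>
  Split off the multiples of \<open>p\<close> from \<open>s\<close> and \<open>t\<close>. Modulo \<open>p\<close>, the \<open>p\<close>-th power of
  \<open>(1 + z) ^ j - 1\<close> is \<open>(1 + z) ^ (p * j) - 1\<close> and the \<open>p\<close>-th power of \<open>fdiff 1\<close> is \<open>fdiff p\<close>.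
  Each of these contributes \<open>z ^ p\<close>, independently of the other, by the Leibniz rule
  behind \<open>fdiff_filt_mult\<close>.
\<close>

lemma grid_coeff_in_filt:
  fixes z :: "'a::comm_ring_1"
  assumes p: "prime p"
  shows "grid_coeff z s t \<in> filt p z (s + t - 2 * (p - 1))"
proof -
  have p2: "p \<ge> 2" using p by (rule prime_ge_2_nat)
  define h where "h = (\<lambda>j. (1 + z) ^ j - 1)"
  define Y where "Y = (1 + z) ^ p"
  define K where "K = (\<lambda>j. Y ^ j - 1)"
  note pow_minus_1 = prime_dvd_power_minus_one[OF p]
  have Y: "Y - 1 \<in> filt p z p"
    using one_plus_power_prime_power[OF p, of z 1] by (simp add: Y_def)
  \<comment> \<open>The argument yields exponent \<open>p * p\<close>. The weaker
    \<open>2 * p\<close> suffices for \<open>K\<close>, because \<open>2 * p * t\<close> is at least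
    \<open>p + p * t\<close> when \<open>t > 0\<close>.\<close>
  have Yp: "Y ^ p - 1 \<in> filt p z (2 * p)"
  proof (rule filt_cong)
    show "of_nat p dvd (Y ^ p - 1) - (Y - 1) ^ p"
      by (rule pow_minus_1)
    show "(Y - 1) ^ p \<in> filt p z (2 * p)"
      using p2 by (intro filt_mono[OF filt_power[OF Y, of p]]) simp
  qed
  have h: "h \<in> fdiff_filt p z 0"
    unfolding fdiff_filt_def
  proof clarsimp
    fix t j
    show "(fdiff p ^^ t) h j \<in> filt p z (p * t)"
    proof (cases "t = 0")
      case False
      then show ?thesis
        using filt_mult_right[OF filt_power[OF Y]]
        by (simp add: h_def fdiff_pow_power_minus_one Y_def)
    qed simp
  qed
  have K: "K \<in> fdiff_filt p z p"
    unfolding fdiff_filt_def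
  proof clarsimp
    fix t j
    show "(fdiff p ^^ t) K j \<in> filt p z (p + p * t)"
    proof (cases "t = 0")
      case True
      have "K j = (Y - 1) * (\<Sum>i<j. Y ^ i)"
        unfolding K_def by (rule power_diff_1_eq)
      then show ?thesis using True filt_mult_right[OF Y] by simp
    next
      case False
      then have "(fdiff p ^^ t) K j = (Y ^ p - 1) ^ t * Y ^ j"
        by (simp add: K_def fdiff_pow_power_minus_one)
      moreover have "(Y ^ p - 1) ^ t * Y ^ j \<in> filt p z (2 * p * t)"
        by (intro filt_mult_right filt_power Yp)
      ultimately show ?thesis
        using False by (auto elim!: filt_mono)
    qed
  qed
  have hK: "of_nat p dvd K j - h j ^ p" for j
    using pow_minus_1[of "(1 + z) ^ j"]
    by (simp add: h_def K_def Y_def mult.commute flip: power_mult)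
  \<comment> \<open>The remainders contribute no power of \<open>z\<close>: \<open>h\<close> has
    order 0, and unit differences merely preserve the ideal. Each remainder is at most
    \<open>p - 1\<close>, whence the loss of \<open>2 * (p - 1)\<close>.\<close>
  define r s' where "r = s mod p" and "s' = s div p"
  have s: "s = r + p * s'" by (simp add: r_def s'_def)
  define r' t' where "r' = t mod p" and "t' = t div p"
  have t: "t = r' + p * t'" by (simp add: r'_def t'_def)
  define F where "F = (\<lambda>j. h j ^ r * K j ^ s')"
  have F: "F \<in> fdiff_filt p z (p * s')"
    unfolding F_def using fdiff_filt_mult[OF fdiff_filt_power[OF h] fdiff_filt_power[OF K]] by simp
  have hF: "of_nat p dvd F j - h j ^ s" for j
  proof -
    have "K j - h j ^ p dvd K j ^ s' - (h j ^ p) ^ s'"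
      by (simp add: power_diff_sumr2)
    then have "of_nat p dvd h j ^ r * (K j ^ s' - (h j ^ p) ^ s')"
      using hK[of j] by (meson dvd_mult dvd_trans)
    then show ?thesis
      by (simp add: F_def s power_add power_mult algebra_simps)
  qed
  have "(fdiff 1 ^^ (p * t')) (\<lambda>j. h j ^ s) j \<in> filt p z (p * s' + p * t')" for j
  proof (rule filt_cong)
    show "(fdiff p ^^ t') F j \<in> filt p z (p * s' + p * t')"
      by (rule fdiff_filtD[OF F])
    show "of_nat p dvd (fdiff 1 ^^ (p * t')) (\<lambda>j. h j ^ s) j - (fdiff p ^^ t') F j"
      using dvd_diff[OF fdiff_prime_cong[OF p, of t' F j]
          fdiff_pow_cong_dvd[where f = F and g = "\<lambda>j. h j ^ s" and c = 1 and t = "p * t'" and j = j, OF hF]] by simp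
  qed
  then have "(fdiff 1 ^^ r') ((fdiff 1 ^^ (p * t')) (\<lambda>j. h j ^ s)) 0 \<in> filt p z (p * s' + p * t')"
    by (rule fdiff_pow_filt)
  then have "grid_coeff z s t \<in> filt p z (p * s' + p * t')"
    by (simp add: grid_coeff_def h_def t funpow_add)
  moreover have "r \<le> p - 1" "r' \<le> p - 1"
    using p2 by (simp_all add: r_def r'_def less_Suc_eq_le[symmetric])
  ultimately show ?thesis
    by (elim filt_mono) (simp add: s t)
qed

section \<open>Coefficients of integer polynomials and binomials as indicators modulo p\<close>

lemma dvd_coeff_of_filt:
  fixes f :: "int poly"
  assumes "f \<in> filt p [:0, 1:] e" "m < e"
  shows "int p dvd coeff f m"
proof -
  obtain u v where f: "f = of_nat p * u + [:0, 1:] ^ e * v"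
    using assms(1) by (auto simp: filt_def)
  have "[:0, 1:] ^ e = (monom 1 e :: int poly)" by (simp add: monom_altdef)
  then have "coeff f m = int p * coeff u m"
    using assms(2) by (simp add: f coeff_monom_mult of_nat_poly)
  then show ?thesis by simp
qed

lemma coeff_one_plus_X_power:
  "coeff ((1 + [:0, 1:]) ^ t :: int poly) m = int (t choose m)"
proof (cases "m \<le> t")
  case True
  then show ?thesis by (simp add: coeff_linear_poly_power one_pCons)
next
  case False
  have "degree ([:1, 1:] ^ t :: int poly) = t" by (simp add: degree_linear_power)
  then show ?thesis using False by (simp add: one_pCons coeff_eq_0 binomial_eq_0)
qed

text \<open>Modulo \<open>p\<close> and \<open>z ^ q\<close> one has \<open>(1 + z) ^ q = 1\<close>,
  so the coefficient of \<open>z ^ (q - 1)\<close> in \<open>(1 + z) ^ t\<close> depends only on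
  \<open>u = t mod q\<close>. As \<open>u < q\<close>, it is nonzero only for
  \<open>u = q - 1\<close>.\<close>

lemma choose_prime_power_minus_one:
  assumes p: "prime p"
  shows "int (t choose (p ^ k - 1)) mod int p = (if p ^ k dvd t + 1 then 1 else 0)"
proof -
  define q where "q = p ^ k"
  have q: "q > 0" using p by (simp add: q_def prime_gt_0_nat)
  define r u where "r = t div q" and "u = t mod q"
  have t: "t = q * r + u" and u: "u < q" using q by (simp_all add: r_def u_def)
  let ?y = "1 + [:0, 1:] :: int poly"
  have "?y ^ q - 1 \<in> filt p [:0, 1:] q"
    unfolding q_def by (rule one_plus_power_prime_power[OF p])
  moreover have "?y ^ t - ?y ^ u = ((?y ^ q) ^ r - 1) * ?y ^ u"
    by (simp add: t power_add power_mult left_diff_distrib)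
  then have "?y ^ t - ?y ^ u = (?y ^ q - 1) * ((\<Sum>i<r. (?y ^ q) ^ i) * ?y ^ u)"
    by (simp only: power_diff_1_eq[of "?y ^ q" r] mult.assoc)
  ultimately have "?y ^ t - ?y ^ u \<in> filt p [:0, 1:] q"
    by (simp only: filt_mult_right)
  then have "int p dvd coeff (?y ^ t - ?y ^ u) (q - 1)"
    using q by (intro dvd_coeff_of_filt) auto
  then have "int p dvd int (t choose (q - 1)) - int (u choose (q - 1))"
    by (simp only: coeff_diff coeff_one_plus_X_power)
  then have "int (t choose (q - 1)) mod int p = int (u choose (q - 1)) mod int p"
    by (simp add: mod_eq_dvd_iff)
  also have "u choose (q - 1) = (if u = q - 1 then 1 else 0)"
    using u by (auto simp: binomial_eq_0)
  also have "u = q - 1 \<longleftrightarrow> q dvd t + 1"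
  proof -
    have "q dvd t + 1 \<longleftrightarrow> q dvd u + 1"
      unfolding t add.assoc by (rule dvd_add_right_iff) simp
    also have "\<dots> \<longleftrightarrow> u = q - 1"
      using u q dvd_imp_le[of q "u + 1"] by auto
    finally show ?thesis by simp
  qed
  finally show ?thesis
    using prime_gt_1_nat[OF p] by (simp add: q_def)
qed

text \<open>The counterpart of \<open>one_plus_power_mult\<close> for the coordinate
  \<open>i0\<close>. Its coefficient \<open>z ^ (s + t)\<close> has full order, so this coordinate
  causes no loss.\<close>

lemma one_plus_power_add:
  fixes z :: "'a::comm_ring_1"
  assumes "b \<le> m" "x \<le> m"
  shows "(1 + z) ^ (b + x) =
    (\<Sum>s\<le>m. \<Sum>t\<le>m. of_nat (b choose s) * of_nat (x choose t) * z ^ (s + t))"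
  using power_eq_sum_choose[OF assms(1), of "1 + z"] power_eq_sum_choose[OF assms(2), of "1 + z"]
  by (simp add: power_add sum_product algebra_simps)

section \<open>Expansion of the incidence function\<close>

text \<open>The expansions of the coordinates are multiplied and the coefficient of
  \<open>z ^ (q - 1)\<close> is read off; it is a multiple of \<open>p\<close> once the orders sum
  to more than \<open>q - 1\<close>. The coefficients \<open>w\<close> do not depend on
  \<open>b\<close> and \<open>x\<close>.\<close>

lemma incidence_expansion:
  fixes p k n i0 :: nat
  defines "q \<equiv> p ^ k" and "S \<equiv> {..<n} \<rightarrow>\<^sub>E {..<p ^ k}"
  assumes p: "prime p" and i0: "i0 < n"
  obtains w :: "(nat \<Rightarrow> nat) \<Rightarrow> (nat \<Rightarrow> nat) \<Rightarrow> int" where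
    "\<And>\<sigma> \<tau>. \<not> int p dvd w \<sigma> \<tau> \<Longrightarrow> sum \<sigma> {..<n} + sum \<tau> {..<n} \<le> q - 1 + 2 * ((n - 1) * (p - 1))"
    "\<And>b x. b \<in> S \<Longrightarrow> x \<in> S \<Longrightarrow>
      int ((b i0 + x i0 + (\<Sum>i\<in>{..<n} - {i0}. b i * x i)) choose (q - 1)) =
      (\<Sum>\<tau>\<in>S. \<Sum>\<sigma>\<in>S. w \<sigma> \<tau> * int (\<Prod>i<n. b i choose \<tau> i) * int (\<Prod>i<n. x i choose \<sigma> i))"
proof -
  let ?z = "[:0, 1:] :: int poly"
  define P where "P = (\<lambda>i s t. if i = i0 then ?z ^ (s + t) else grid_coeff ?z s t)"
  define w where "w = (\<lambda>\<sigma> \<tau>. coeff (\<Prod>i<n. P i (\<tau> i) (\<sigma> i)) (q - 1))"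
  have q: "q > 0" using p by (simp add: q_def prime_gt_0_nat)
  show ?thesis
  proof (rule that[of w])
    fix \<sigma> \<tau> :: "nat \<Rightarrow> nat"
    assume nd: "\<not> int p dvd w \<sigma> \<tau>"
    \<comment> \<open>The subtraction truncates, but adding the loss back still bounds
      \<open>\<tau> i + \<sigma> i\<close> from above.\<close>
    define e where "e = (\<lambda>i. \<tau> i + \<sigma> i - (if i = i0 then 0 else 2 * (p - 1)))"
    have "P i (\<tau> i) (\<sigma> i) \<in> filt p ?z (e i)" for i
      using grid_coeff_in_filt[OF p, of ?z "\<tau> i" "\<sigma> i"] by (auto simp: P_def e_def)
    then have "(\<Prod>i<n. P i (\<tau> i) (\<sigma> i)) \<in> filt p ?z (\<Sum>i<n. e i)"
      by (intro filt_prod)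
    then have "\<not> q - 1 < (\<Sum>i<n. e i)"
      using nd dvd_coeff_of_filt unfolding w_def by blast
    moreover have "(\<Sum>i<n. \<tau> i + \<sigma> i) \<le> (\<Sum>i<n. e i) + 2 * ((n - 1) * (p - 1))"
    proof -
      have "(\<Sum>i<n. \<tau> i + \<sigma> i) \<le> (\<Sum>i<n. e i + (if i = i0 then 0 else 2 * (p - 1)))"
        by (intro sum_mono) (simp add: e_def)
      also have "\<dots> = (\<Sum>i<n. e i) + (\<Sum>i<n. if i = i0 then 0 else 2 * (p - 1))"
        by (rule sum.distrib)
      also have "(\<Sum>i<n. if i = i0 then 0 else 2 * (p - 1)) = (\<Sum>i\<in>{..<n} - {i0}. 2 * (p - 1))"
        by (intro sum.mono_neutral_cong_right) auto
      also have "\<dots> = 2 * ((n - 1) * (p - 1))"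
        using i0 by simp
      finally show ?thesis .
    qed
    ultimately show "sum \<sigma> {..<n} + sum \<tau> {..<n} \<le> q - 1 + 2 * ((n - 1) * (p - 1))"
      by (simp add: sum.distrib)
  next
    fix b x assume b: "b \<in> S" and x: "x \<in> S"
    let ?f = "\<lambda>i. if i = i0 then b i + x i else b i * x i"
    have f: "(\<Sum>i<n. ?f i) = b i0 + x i0 + (\<Sum>i\<in>{..<n} - {i0}. b i * x i)"
      using i0 by (subst sum.remove[of _ i0]) auto
    have atMost: "{..q - 1} = {..<q}" using q by auto
    have one: "(1 + ?z) ^ ?f i =
        (\<Sum>s<q. \<Sum>t<q. of_nat (b i choose s) * of_nat (x i choose t) * P i s t)" if "i < n" for i
    proof -
      have "b i \<le> q - 1" "x i \<le> q - 1"
        using b x that by (auto simp: S_def q_def dest!: PiE_mem[of _ _ _ i])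
      then show ?thesis
        using one_plus_power_add[of "b i" "q - 1" "x i" ?z] one_plus_power_mult[of "b i" "q - 1" "x i" ?z]
        by (auto simp: P_def atMost simp del: One_nat_def)
    qed
    have "(1 + ?z) ^ (\<Sum>i<n. ?f i) =
        (\<Prod>i<n. \<Sum>s<q. \<Sum>t<q. of_nat (b i choose s) * of_nat (x i choose t) * P i s t)"
      by (simp add: power_sum one cong: prod.cong_simp)
    also have "\<dots> = (\<Sum>\<tau>\<in>S. \<Sum>\<sigma>\<in>S. \<Prod>i<n. of_nat (b i choose \<tau> i) * of_nat (x i choose \<sigma> i) * P i (\<tau> i) (\<sigma> i))"
      by (simp add: prod_sum_PiE S_def q_def)
    also have "\<dots> = (\<Sum>\<tau>\<in>S. \<Sum>\<sigma>\<in>S. of_nat (\<Prod>i<n. b i choose \<tau> i) *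
        (of_nat (\<Prod>i<n. x i choose \<sigma> i) * (\<Prod>i<n. P i (\<tau> i) (\<sigma> i))))"
      by (simp add: prod.distrib mult.assoc)
    finally have "coeff ((1 + ?z) ^ (\<Sum>i<n. ?f i)) (q - 1) =
      (\<Sum>\<tau>\<in>S. \<Sum>\<sigma>\<in>S. int (\<Prod>i<n. b i choose \<tau> i) * (int (\<Prod>i<n. x i choose \<sigma> i) * w \<sigma> \<tau>))"
      by (simp add: coeff_sum of_nat_poly w_def mult_ac del: of_nat_prod)
    then show "int ((b i0 + x i0 + (\<Sum>i\<in>{..<n} - {i0}. b i * x i)) choose (q - 1)) =
      (\<Sum>\<tau>\<in>S. \<Sum>\<sigma>\<in>S. w \<sigma> \<tau> * int (\<Prod>i<n. b i choose \<tau> i) * int (\<Prod>i<n. x i choose \<sigma> i))"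
      unfolding coeff_one_plus_X_power f by (simp only: mult_ac)
  qed
qed

section \<open>Rank bounds\<close>

lemma func_space_vectorspace: "field K \<Longrightarrow> vectorspace K (ring.func_space K J)"
proof -
  assume "field K"
  then interpret field K .
  show ?thesis
    using \<open>field K\<close> func_space_is_module by (simp add: vectorspace_def)
qed

text \<open>A basis of \<open>span T\<close> is independent in the whole space and lies in
  \<open>span S\<close>, so the exchange lemma bounds its size.\<close>

lemma (in vectorspace) dim_span_le_card:
  assumes T: "finite T" "T \<subseteq> carrier V" and S: "finite S" "S \<subseteq> carrier V" and TS: "T \<subseteq> span S"
  shows "vectorspace.dim K (V\<lparr>carrier := span T\<rparr>) \<le> card S"
proof -
  have sub: "subspace K (span T) V" and sm: "submodule K (span T) V"
    using span_is_subspace[OF T(2)] span_is_submodule[OF T(2)] by auto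
  interpret W: vectorspace K "vs (span T)"
    by (rule subspace_is_vs[OF sub])
  have Tsp: "T \<subseteq> span T" by (rule in_own_span[OF T(2)])
  have "W.gen_set T"
    using span_li_not_depend(1)[OF Tsp sm] by simp
  then have "W.fin_dim"
    using T(1) Tsp unfolding W.fin_dim_def by auto
  then obtain A where A: "finite A" "W.basis A"
    using W.finite_basis_exists by blast
  then have Asp: "A \<subseteq> span T" and li: "\<not> W.lin_dep A"
    by (auto simp: W.basis_def)
  have "\<not> lin_dep A"
    using li span_li_not_depend(2)[OF Asp sm] by simp
  moreover have "A \<subseteq> span S"
    using Asp span_is_subset[OF TS span_is_submodule[OF S(2)]] by blast
  ultimately have "int (card A) \<le> int (card S)"
    using replacement[OF A(1) S] by force
  then show ?thesis
    using W.dim_basis[OF A] by simp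
qed

lemma matrix_rank_le_card:
  assumes K: "field K" and I: "finite I" and S: "finite S" "S \<subseteq> carrier (ring.func_space K J)"
    and M: "\<And>i. i \<in> I \<Longrightarrow> restrict (M i) J \<in> module.span K (ring.func_space K J) S"
  shows "matrix_rank K I J M \<le> card S"
proof -
  interpret vectorspace K "ring.func_space K J"
    by (rule func_space_vectorspace[OF K])
  have "(\<lambda>i. restrict (M i) J) ` I \<subseteq> span S" using M by auto
  then show ?thesis
    unfolding matrix_rank_def Let_def
    using I S span_is_subset2[OF S(2)] by (intro dim_span_le_card) auto
qed

text \<open>Reduction modulo \<open>p\<close> commutes with sums and products, so span membership
  can be shown with integer coefficients and one reduction at the end.\<close>

lemma sum_mod_in_span:
  fixes p :: nat and J :: "'x set" and c :: "'i \<Rightarrow> int" and h :: "'i \<Rightarrow> 'x \<Rightarrow> int"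
  defines "V \<equiv> ring.func_space (residue_ring (int p)) J"
  assumes p: "prime p" and S: "S \<subseteq> carrier V"
    and h: "\<And>g. g \<in> A \<Longrightarrow> (\<lambda>x\<in>J. h g x mod int p) \<in> module.span (residue_ring (int p)) V S"
  shows "(\<lambda>x\<in>J. (\<Sum>g\<in>A. c g * h g x) mod int p) \<in> module.span (residue_ring (int p)) V S"
proof -
  let ?K = "residue_ring (int p)"
  have K: "residues_prime p" using p by (simp add: residues_prime_def)
  interpret K: residues_prime p ?K by (rule K) simp
  interpret vectorspace ?K V
    unfolding V_def by (rule func_space_vectorspace[OF K.is_field])
  interpret W: submodule ?K "span S" V by (rule span_is_submodule[OF S])
  have V: "\<zero>\<^bsub>V\<^esub> = (\<lambda>x\<in>J. 0)" "f \<oplus>\<^bsub>V\<^esub> g = (\<lambda>x\<in>J. (f x + g x) mod int p)"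
    "a \<odot>\<^bsub>V\<^esub> f = (\<lambda>x\<in>J. (a * f x) mod int p)" for a f g
    unfolding V_def K.func_space_def by (simp_all add: residue_ring_def)
  show ?thesis
    using h
  proof (induction A rule: infinite_finite_induct)
    case (insert g A)
    have "(c g mod int p) \<odot>\<^bsub>V\<^esub> (\<lambda>x\<in>J. h g x mod int p) \<in> span S"
      by (intro W.smult_closed insert.prems K.mod_in_carrier) simp
    moreover have "(\<lambda>x\<in>J. (\<Sum>g\<in>A. c g * h g x) mod int p) \<in> span S"
      using insert.IH insert.prems by blast
    ultimately have "(c g mod int p) \<odot>\<^bsub>V\<^esub> (\<lambda>x\<in>J. h g x mod int p) \<oplus>\<^bsub>V\<^esub>
        (\<lambda>x\<in>J. (\<Sum>g\<in>A. c g * h g x) mod int p) \<in> span S"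
      by (rule W.m_closed)
    also have "(c g mod int p) \<odot>\<^bsub>V\<^esub> (\<lambda>x\<in>J. h g x mod int p) \<oplus>\<^bsub>V\<^esub>
        (\<lambda>x\<in>J. (\<Sum>g\<in>A. c g * h g x) mod int p) = (\<lambda>x\<in>J. (\<Sum>g\<in>insert g A. c g * h g x) mod int p)"
      using insert.hyps by (auto simp: V fun_eq_iff mod_simps)
    finally show ?case .
  qed (use W.zero_closed in \<open>simp_all add: V\<close>)
qed

text \<open>Stars and bars: the slack \<open>d - sum \<sigma> {..<n}\<close>, put in front as an
  extra entry, gives lists of length \<open>n + 1\<close> with sum exactly \<open>d\<close>.\<close>

lemma card_bounded_sum_le:
  "card {\<sigma> \<in> {..<n} \<rightarrow>\<^sub>E {..<q::nat}. sum \<sigma> {..<n} \<le> d} \<le> (d + n) choose n"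
proof -
  let ?A = "{\<sigma> \<in> {..<n} \<rightarrow>\<^sub>E {..<q::nat}. sum \<sigma> {..<n} \<le> d}"
  let ?B = "{l::nat list. length l = n + 1 \<and> sum_list l = d}"
  let ?f = "\<lambda>\<sigma>. (d - sum \<sigma> {..<n}) # map \<sigma> [0..<n]"
  have cardB: "card ?B = (d + n) choose d" by (simp only: card_length_sum_list) simp
  then have "card ?B > 0" by simp
  then have "finite ?B" by (rule card_ge_0_finite)
  have "inj_on ?f ?A"
  proof (rule inj_onI)
    fix \<sigma> \<sigma>' assume "\<sigma> \<in> ?A" "\<sigma>' \<in> ?A" "?f \<sigma> = ?f \<sigma>'"
    then show "\<sigma> = \<sigma>'" by (intro PiE_ext[of _ "{..<n}" "\<lambda>_. {..<q}"]) auto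
  qed
  moreover have "?f ` ?A \<subseteq> ?B"
  proof (rule image_subsetI)
    fix \<sigma> assume "\<sigma> \<in> ?A"
    moreover have "sum_list (map \<sigma> [0..<n]) = sum \<sigma> {..<n}"
      by (simp add: interv_sum_list_conv_sum_set_nat atLeast0LessThan)
    ultimately show "?f \<sigma> \<in> ?B" by simp
  qed
  ultimately have "card ?A \<le> card ?B"
    using \<open>finite ?B\<close> by (rule card_inj_on_le)
  also have "\<dots> = (d + n) choose n"
    using cardB binomial_symmetric[of d "d + n"] by simp
  finally show ?thesis .
qed

section \<open>Hyperplanes over the integers modulo m\<close>

lemma finsum_Zmod:
  assumes m: "m > 0" and A: "finite A"
  shows "(\<Oplus>\<^bsub>Zmod m\<^esub>i\<in>A. f i mod int m) = (\<Sum>i\<in>A. f i) mod int m"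
proof -
  interpret cring "Zmod m" by (rule cring_Zmod[OF m])
  have car: "f i mod int m \<in> carrier (Zmod m)" for i
    using m by (simp add: Zmod_def residue_ring_def)
  show ?thesis
    using A by induction (simp_all add: car, simp_all add: Zmod_def residue_ring_def mod_simps)
qed

lemma minus_Zmod:
  assumes m: "m > 0" and xy: "x \<in> carrier (Zmod m)" "y \<in> carrier (Zmod m)"
  shows "x \<ominus>\<^bsub>Zmod m\<^esub> y = (x - y) mod int m"
proof -
  interpret cring "Zmod m" by (rule cring_Zmod[OF m])
  have "(- y) mod int m \<oplus>\<^bsub>Zmod m\<^esub> y = \<zero>\<^bsub>Zmod m\<^esub>"
    by (simp add: Zmod_def residue_ring_def mod_simps)
  moreover have "(- y) mod int m \<in> carrier (Zmod m)"
    using m by (simp add: Zmod_def residue_ring_def)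
  ultimately have "\<ominus>\<^bsub>Zmod m\<^esub> y = (- y) mod int m"
    using xy(2) by (intro minus_equality)
  then show ?thesis
    by (simp add: a_minus_def) (simp add: Zmod_def residue_ring_def mod_simps)
qed

lemma vec_hyperplane_Zmod_iff:
  assumes m: "m > 0" and "a \<in> vecs (Zmod m) n" "b \<in> vecs (Zmod m) n" "x \<in> vecs (Zmod m) n"
  shows "x \<in> vec_hyperplane (Zmod m) n a b \<longleftrightarrow> int m dvd (\<Sum>i<n. (x i - a i) * b i)"
proof -
  interpret cring "Zmod m" by (rule cring_Zmod[OF m])
  have car: "a i \<in> carrier (Zmod m)" "b i \<in> carrier (Zmod m)" "x i \<in> carrier (Zmod m)" if "i < n" for i
    using assms that by (auto simp: vecs_def)
  have "vec_inner (Zmod m) n (vec_minus (Zmod m) n x a) b =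
      (\<Oplus>\<^bsub>Zmod m\<^esub>i\<in>{..<n}. ((x i - a i) * b i) mod int m)"
    unfolding vec_inner_def
  proof (rule finsum_cong')
    show "(\<lambda>i. ((x i - a i) * b i) mod int m) \<in> {..<n} \<rightarrow> carrier (Zmod m)"
      using m by (auto simp: Zmod_def residue_ring_def)
    show "vec_minus (Zmod m) n x a i \<otimes>\<^bsub>Zmod m\<^esub> b i = ((x i - a i) * b i) mod int m"
      if "i \<in> {..<n}" for i
      using that car minus_Zmod[OF m, of "x i" "a i"]
      by (simp add: vec_minus_def) (simp add: Zmod_def residue_ring_def mod_simps)
  qed simp
  also have "\<dots> = (\<Sum>i<n. (x i - a i) * b i) mod int m"
    by (rule finsum_Zmod[OF m]) simp
  finally show ?thesis
    using assms by (simp add: vec_hyperplane_def dvd_eq_mod_eq_0) (simp add: Zmod_def residue_ring_def)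
qed

text \<open>Once the unit coordinate is scaled to 1, slot \<open>i0\<close> of \<open>b\<close> is
  free to hold the offset. The final \<open>+ 1\<close> matches the condition in
  \<open>choose_prime_power_minus_one\<close>.\<close>

lemma hyperplane_normal_form:
  assumes m: "m > 0" and a: "a \<in> vecs (Zmod m) n" and B: "B \<in> proj_space (Zmod m) n"
  obtains i0 b where "i0 < n" "b \<in> {..<n} \<rightarrow>\<^sub>E {..<m}"
    "\<And>x. x \<in> vecs (Zmod m) n \<Longrightarrow> x \<in> proj_hyperplane (Zmod m) n a B \<longleftrightarrow>
      m dvd b i0 + nat (x i0) + (\<Sum>i\<in>{..<n} - {i0}. b i * nat (x i)) + 1"
proof -
  interpret cring "Zmod m" by (rule cring_Zmod[OF m])
  have equiv: "equiv (unit_sphere (Zmod m) n) (proj_rel (Zmod m) n)" by (rule equiv_proj_rel)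
  obtain c where c: "c \<in> B"
    using in_quotient_imp_non_empty[OF equiv] B by (auto simp: proj_space_def)
  then have cs: "c \<in> unit_sphere (Zmod m) n"
    using in_quotient_imp_subset[OF equiv] B by (auto simp: proj_space_def)
  then obtain i0 where i0: "i0 < n" and u: "c i0 \<in> Units (Zmod m)" and cv: "c \<in> vecs (Zmod m) n"
    by (auto simp: unit_sphere_def)
  define d where "d = vec_scale (Zmod m) n (inv\<^bsub>Zmod m\<^esub> (c i0)) c"
  have dv: "d \<in> vecs (Zmod m) n"
    unfolding d_def using u cv by (intro vec_scale_in_vecs) auto
  have H: "proj_hyperplane (Zmod m) n a B = vec_hyperplane (Zmod m) n a d"
    unfolding d_def using u cv a by (simp add: proj_hyperplane_class[OF a B c] vec_hyperplane_scale)
  \<comment> \<open>Reducing the 1 covers the zero ring \<open>m = 1\<close>, which arises from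
    \<open>k = 0\<close>.\<close>
  have d1: "d i0 = 1 mod int m"
    using i0 u by (simp add: d_def vec_scale_def) (simp add: Zmod_def)
  have car: "0 \<le> v i" "v i < int m" if "v \<in> vecs (Zmod m) n" "i < n" for v i
    using that by (auto simp: vecs_def Zmod_def residue_ring_def dest!: PiE_mem[of _ _ _ i])
  define e where "e = (\<Sum>i<n. a i * d i)"
  \<comment> \<open>The entry \<open>-1 - e\<close> cancels the final \<open>+ 1\<close> and leaves
    the offset \<open>-e\<close>, where \<open>e\<close> is the inner product of \<open>a\<close>
    and \<open>d\<close>.\<close>
  define b where "b = (\<lambda>i\<in>{..<n}. nat (if i = i0 then (- 1 - e) mod int m else d i))"
  show ?thesis
  proof (rule that[OF i0, of b])
    show "b \<in> {..<n} \<rightarrow>\<^sub>E {..<m}"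
      using car[OF dv] m by (auto simp: b_def nat_less_iff)
    fix x assume x: "x \<in> vecs (Zmod m) n"
    let ?r = "\<Sum>i\<in>{..<n} - {i0}. d i * x i"
    have r: "int (\<Sum>i\<in>{..<n} - {i0}. b i * nat (x i)) = ?r"
      unfolding of_nat_sum using car[OF dv] car[OF x] by (intro sum.cong) (auto simp: b_def)
    have "m dvd b i0 + nat (x i0) + (\<Sum>i\<in>{..<n} - {i0}. b i * nat (x i)) + 1 \<longleftrightarrow>
        int m dvd (- 1 - e) mod int m + x i0 + ?r + 1"
      unfolding int_dvd_int_iff[symmetric] of_nat_add r
      using i0 m car[OF x i0] by (simp add: b_def)
    also have "\<dots> \<longleftrightarrow> int m dvd x i0 + ?r - e"
      using mod_add_left_eq[of "- 1 - e" "int m" "x i0 + ?r + 1"]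
      by (simp add: dvd_eq_mod_eq_0 algebra_simps)
    also have "\<dots> \<longleftrightarrow> int m dvd x i0 * (1 mod int m) + ?r - e"
      using m by (cases "m = 1") simp_all
    also have "x i0 * (1 mod int m) + ?r - e = (\<Sum>i<n. (x i - a i) * d i)"
    proof -
      have "(\<Sum>i<n. x i * d i) = x i0 * (1 mod int m) + ?r"
        using i0 by (subst sum.remove[of _ i0]) (simp_all add: d1 mult.commute)
      then show ?thesis by (simp add: e_def left_diff_distrib sum_subtractf)
    qed
    finally show "x \<in> proj_hyperplane (Zmod m) n a B \<longleftrightarrow>
        m dvd b i0 + nat (x i0) + (\<Sum>i\<in>{..<n} - {i0}. b i * nat (x i)) + 1"
      by (simp add: H vec_hyperplane_Zmod_iff[OF m a dv x])
  qed
qed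

section \<open>A common spanning set for the rows and its size\<close>

theorem theorem1p4:
  fixes p k n :: nat
  assumes "prime p"
  shows "rank_Astar p k n \<le> 2 * n * ((p ^ k div 2 + (n - 1) * (p - 1) + n) choose n)"
proof -
  define q where "q = p ^ k"
  define d where "d = q div 2 + (n - 1) * (p - 1)"
  define S where "S = {..<n} \<rightarrow>\<^sub>E {..<q}"
  define J where "J = vecs (Zmod q) n"
  define Low where "Low = {\<sigma> \<in> S. sum \<sigma> {..<n} \<le> d}"
  define K where "K = residue_ring (int p)"
  define X where "X = (\<lambda>\<sigma> (x :: nat \<Rightarrow> int). int (\<Prod>i<n. nat (x i) choose \<sigma> i))"
  have q: "q > 0" using assms by (simp add: q_def prime_gt_0_nat)
  have finS: "finite S" by (simp add: S_def finite_PiE)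
  have LowS: "Low \<subseteq> S" and finLow: "finite Low" using finS by (auto simp: Low_def)
  have "\<forall>i0<n. \<exists>w :: (nat \<Rightarrow> nat) \<Rightarrow> (nat \<Rightarrow> nat) \<Rightarrow> int.
      (\<forall>\<sigma> \<tau>. \<not> int p dvd w \<sigma> \<tau> \<longrightarrow> sum \<sigma> {..<n} + sum \<tau> {..<n} \<le> q - 1 + 2 * ((n - 1) * (p - 1))) \<and>
      (\<forall>b\<in>S. \<forall>x\<in>S. int ((b i0 + x i0 + (\<Sum>i\<in>{..<n} - {i0}. b i * x i)) choose (q - 1)) =
        (\<Sum>\<tau>\<in>S. \<Sum>\<sigma>\<in>S. w \<sigma> \<tau> * int (\<Prod>i<n. b i choose \<tau> i) * int (\<Prod>i<n. x i choose \<sigma> i)))"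
    unfolding q_def S_def
    by (intro allI impI, rule incidence_expansion[OF assms]) (assumption, blast)
  \<comment> \<open>One family per \<open>i0\<close> is fixed before any row is considered, so that
    \<open>G\<close> serves all rows.\<close>
  from this[unfolded choice_iff'] obtain w :: "nat \<Rightarrow> (nat \<Rightarrow> nat) \<Rightarrow> (nat \<Rightarrow> nat) \<Rightarrow> int" where
    w_deg: "\<And>i0 \<sigma> \<tau>. i0 < n \<Longrightarrow> \<not> int p dvd w i0 \<sigma> \<tau> \<Longrightarrow>
      sum \<sigma> {..<n} + sum \<tau> {..<n} \<le> q - 1 + 2 * ((n - 1) * (p - 1))" and
    w_exp: "\<And>i0 b x. i0 < n \<Longrightarrow> b \<in> S \<Longrightarrow> x \<in> S \<Longrightarrow>
      int ((b i0 + x i0 + (\<Sum>i\<in>{..<n} - {i0}. b i * x i)) choose (q - 1)) =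
        (\<Sum>\<tau>\<in>S. \<Sum>\<sigma>\<in>S. w i0 \<sigma> \<tau> * int (\<Prod>i<n. b i choose \<tau> i) * int (\<Prod>i<n. x i choose \<sigma> i))"
    by blast
  \<comment> \<open>For a low \<open>\<tau>\<close> all high \<open>\<sigma>\<close> are bundled
    into a single function of \<open>x\<close>, free of \<open>b\<close>.\<close>
  define Y where "Y = (\<lambda>i0 \<tau> x. \<Sum>\<sigma>\<in>S - Low. w i0 \<sigma> \<tau> * X \<sigma> x)"
  define red where "red = (\<lambda>f :: (nat \<Rightarrow> int) \<Rightarrow> int. \<lambda>x\<in>J. f x mod int p)"
  \<comment> \<open>Each \<open>i0\<close> supplies one block of two families indexed by
    \<open>Low\<close>; the \<open>X\<close> family recurs in every block and is counted each
    time.\<close>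
  define G where "G = (\<Union>i0<n. (\<lambda>\<sigma>. red (X \<sigma>)) ` Low \<union> (\<lambda>\<tau>. red (Y i0 \<tau>)) ` Low)"
  have "card Low \<le> (d + n) choose n"
    unfolding Low_def S_def by (rule card_bounded_sum_le)
  then have "card ((\<lambda>\<sigma>. red (X \<sigma>)) ` Low \<union> (\<lambda>\<tau>. red (Y i0 \<tau>)) ` Low) \<le> 2 * ((d + n) choose n)" for i0
    using card_Un_le[of "(\<lambda>\<sigma>. red (X \<sigma>)) ` Low" "(\<lambda>\<tau>. red (Y i0 \<tau>)) ` Low"]
      card_image_le[OF finLow, of "\<lambda>\<sigma>. red (X \<sigma>)"] card_image_le[OF finLow, of "\<lambda>\<tau>. red (Y i0 \<tau>)"]
    by linarith
  then have "card G \<le> (\<Sum>i0<n. 2 * ((d + n) choose n))"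
    unfolding G_def by (intro order.trans[OF card_UN_le] sum_mono) auto
  then have cardG: "card G \<le> 2 * n * ((d + n) choose n)" by simp
  have finG: "finite G" using finLow by (simp add: G_def)
  have Kp: "residues_prime p" using assms by (simp add: residues_prime_def)
  interpret K: residues_prime p K by (rule Kp) (simp add: K_def)
  have GV: "G \<subseteq> carrier (K.func_space J)"
    using prime_gt_0_nat[OF assms] unfolding K.func_space_def
    by (auto simp: G_def red_def K_def residue_ring_def)
  interpret V: vectorspace K "K.func_space J"
    by (rule func_space_vectorspace[OF K.is_field])
  have finJ: "finite J"
    by (simp add: J_def vecs_def Zmod_def residue_ring_def finite_PiE)
  have finI: "finite (J \<times> proj_space (Zmod q) n)"
  proof -
    have "unit_sphere (Zmod q) n \<subseteq> J" by (auto simp: unit_sphere_def J_def)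
    then have "finite (unit_sphere (Zmod q) n)" using finJ by (rule finite_subset)
    moreover have "proj_rel (Zmod q) n \<subseteq> unit_sphere (Zmod q) n \<times> unit_sphere (Zmod q) n"
      by (auto simp: proj_rel_def)
    ultimately have "finite (proj_space (Zmod q) n)"
      unfolding proj_space_def by (rule finite_quotient)
    then show ?thesis using finJ by simp
  qed
  have rows: "restrict (Astar p k n r) J \<in> V.span G" if r: "r \<in> J \<times> proj_space (Zmod q) n" for r
  proof -
    obtain a B where rab: "r = (a, B)" and a: "a \<in> J" and B: "B \<in> proj_space (Zmod q) n"
      using r by auto
    obtain i0 b where i0: "i0 < n" and b: "b \<in> S" and
      H: "\<And>x. x \<in> J \<Longrightarrow> x \<in> proj_hyperplane (Zmod q) n a B \<longleftrightarrow>
        q dvd b i0 + nat (x i0) + (\<Sum>i\<in>{..<n} - {i0}. b i * nat (x i)) + 1"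
      using hyperplane_normal_form[OF q a[unfolded J_def] B] unfolding J_def S_def by blast
    \<comment> \<open>Within one row \<open>b\<close> is fixed, so its binomials act as
      scalars.\<close>
    define c where "c = (\<lambda>\<tau>. int (\<Prod>i<n. b i choose \<tau> i))"
    define f where "f = (\<lambda>\<sigma>. \<Sum>\<tau>\<in>S. w i0 \<sigma> \<tau> * c \<tau>)"
    have split: "(\<Sum>\<tau>\<in>S. \<Sum>\<sigma>\<in>S. w i0 \<sigma> \<tau> * c \<tau> * X \<sigma> x) mod int p =
        ((\<Sum>\<sigma>\<in>Low. f \<sigma> * X \<sigma> x) + (\<Sum>\<tau>\<in>Low. c \<tau> * Y i0 \<tau> x)) mod int p" for x
    proof -
      \<comment> \<open>Two high exponents sum to at least \<open>2 * d + 2\<close>, and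
        \<open>2 * (q div 2) + 2\<close> is at least \<open>q + 1\<close>, which exceeds the degree
        bound.\<close>
      have high: "int p dvd w i0 \<sigma> \<tau>" if "\<sigma> \<in> S - Low" "\<tau> \<in> S - Low" for \<sigma> \<tau>
      proof (rule ccontr)
        assume "\<not> int p dvd w i0 \<sigma> \<tau>"
        from w_deg[OF i0 this] that show False by (auto simp: Low_def d_def)
      qed
      have "(\<Sum>\<tau>\<in>S. \<Sum>\<sigma>\<in>S. w i0 \<sigma> \<tau> * c \<tau> * X \<sigma> x) =
          (\<Sum>\<tau>\<in>S. \<Sum>\<sigma>\<in>Low. w i0 \<sigma> \<tau> * c \<tau> * X \<sigma> x) + (\<Sum>\<tau>\<in>S. \<Sum>\<sigma>\<in>S - Low. w i0 \<sigma> \<tau> * c \<tau> * X \<sigma> x)"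
        unfolding sum.distrib[symmetric]
        by (intro sum.cong refl) (simp only: sum.subset_diff[OF LowS finS] add.commute)
      also have "(\<Sum>\<tau>\<in>S. \<Sum>\<sigma>\<in>Low. w i0 \<sigma> \<tau> * c \<tau> * X \<sigma> x) = (\<Sum>\<sigma>\<in>Low. f \<sigma> * X \<sigma> x)"
        by (subst sum.swap) (simp add: f_def sum_distrib_right)
      also have "(\<Sum>\<tau>\<in>S. \<Sum>\<sigma>\<in>S - Low. w i0 \<sigma> \<tau> * c \<tau> * X \<sigma> x) = (\<Sum>\<tau>\<in>S. c \<tau> * Y i0 \<tau> x)"
        by (simp add: Y_def sum_distrib_left mult_ac)
      also have "\<dots> = (\<Sum>\<tau>\<in>S - Low. c \<tau> * Y i0 \<tau> x) + (\<Sum>\<tau>\<in>Low. c \<tau> * Y i0 \<tau> x)"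
        by (rule sum.subset_diff[OF LowS finS])
      finally have "(\<Sum>\<tau>\<in>S. \<Sum>\<sigma>\<in>S. w i0 \<sigma> \<tau> * c \<tau> * X \<sigma> x) -
          ((\<Sum>\<sigma>\<in>Low. f \<sigma> * X \<sigma> x) + (\<Sum>\<tau>\<in>Low. c \<tau> * Y i0 \<tau> x)) = (\<Sum>\<tau>\<in>S - Low. c \<tau> * Y i0 \<tau> x)"
        by simp
      moreover have "int p dvd (\<Sum>\<tau>\<in>S - Low. c \<tau> * Y i0 \<tau> x)"
        unfolding Y_def using high by (intro dvd_sum dvd_mult dvd_mult2)
      ultimately show ?thesis by (simp add: mod_eq_dvd_iff)
    qed
    \<comment> \<open>The tags \<open>Inl\<close> and \<open>Inr\<close> keep the two copies of
      \<open>Low\<close> disjoint, so one use of \<open>sum_mod_in_span\<close> treats both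
      families.\<close>
    have row: "Astar p k n r x = (\<Sum>g\<in>Inl ` Low \<union> Inr ` Low.
        case_sum f c g * case_sum X (Y i0) g x) mod int p" if x: "x \<in> J" for x
    proof -
      have xS: "(\<lambda>i\<in>{..<n}. nat (x i)) \<in> S"
        using x by (auto simp: S_def J_def vecs_def Zmod_def residue_ring_def nat_less_iff dest!: PiE_mem)
      have "Astar p k n r x =
          int ((b i0 + nat (x i0) + (\<Sum>i\<in>{..<n} - {i0}. b i * nat (x i))) choose (q - 1)) mod int p"
        using H[OF x] choose_prime_power_minus_one[OF assms, of _ k, folded q_def]
        by (simp add: Astar_def rab residue_ring_def flip: q_def)
      also have "\<dots> = (\<Sum>\<tau>\<in>S. \<Sum>\<sigma>\<in>S. w i0 \<sigma> \<tau> * c \<tau> * X \<sigma> x) mod int p"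
        using w_exp[OF i0 b xS] i0 by (simp add: c_def X_def cong: sum.cong_simp)
      also have "\<dots> = (\<Sum>g\<in>Inl ` Low \<union> Inr ` Low. case_sum f c g * case_sum X (Y i0) g x) mod int p"
        unfolding split using finLow
        by (subst sum.union_disjoint) (auto simp: sum.reindex)
      finally show ?thesis .
    qed
    have "(\<lambda>x\<in>J. (\<Sum>g\<in>Inl ` Low \<union> Inr ` Low. case_sum f c g * case_sum X (Y i0) g x) mod int p) \<in> V.span G"
      unfolding K_def
    proof (rule sum_mod_in_span[OF assms])
      show "G \<subseteq> carrier (ring.func_space (residue_ring (int p)) J)"
        using GV by (simp add: K_def)
      fix g assume "g \<in> Inl ` Low \<union> Inr ` Low"
      then have "red (case_sum X (Y i0) g) \<in> G"
        unfolding G_def using i0 by (intro UN_I[of i0]) auto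
      then have "red (case_sum X (Y i0) g) \<in> V.span G"
        using V.in_own_span[OF GV] by blast
      then show "(\<lambda>x\<in>J. case_sum X (Y i0) g x mod int p) \<in>
          module.span (residue_ring (int p)) (ring.func_space (residue_ring (int p)) J) G"
        by (simp add: red_def K_def)
    qed
    moreover have "restrict (Astar p k n r) J =
        (\<lambda>x\<in>J. (\<Sum>g\<in>Inl ` Low \<union> Inr ` Low. case_sum f c g * case_sum X (Y i0) g x) mod int p)"
      using row by (intro restrict_ext) simp
    ultimately show ?thesis by simp
  qed
  have "rank_Astar p k n \<le> card G"
    unfolding rank_Astar_def q_def[symmetric] J_def[symmetric] K_def[symmetric]
    using K.is_field finI finG GV rows by (rule matrix_rank_le_card)
  with cardG show ?thesis by (simp add: d_def q_def)
qed

end
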